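(* Let $\mathcal{X}\in\mathbb{R}^{I_1\times\cdots\times I_N}$ be a real $N$th-order tensor, let $n\in\{1,\ldots,N\}$, let $\mathfrak{U}_n\subset\mathbb{R}^{I_n}$ be a linear subspace, and let $\mathbf{P}_n\in\mathbb{R}^{I_n\times I_n}$ be the orthogonal projection matrix onto $\mathfrak{U}_n$. Put $\mathcal{X}_+:=\mathcal{X}\times_n\mathbf{P}_n$ and $\mathcal{X}_-:=\mathcal{X}\times_n(\mathbf{I}-\mathbf{P}_n)$. Define the mode-$n$ fiber-wise inner-product tensor $\langle\mathcal{X}_+,\mathcal{X}_-\rangle_{(n)}\in\mathbb{R}^{I_1\times\cdots\times I_{n-1}\times I_{n+1}\times\cdots\times I_N}$ by $$\bigl(\langle\mathcal{X}_+,\mathcal{X}_-\rangle_{(n)}\bigr)_{i_1,\ldots,i_{n-1},i_{n+1},\ldots,i_N}=\bigl\langle\mathcal{X}_+(i_1,\ldots,i_{n-1},:,i_{n+1},\ldots,i_N),\ \mathcal{X}_-(i_1,\ldots,i_{n-1},:,i_{n+1},\ldots,i_N)\bigr\rangle,$$ where the right-hand side is the standard inner product on $\mathbb{R}^{I_n}$. Then $$\langle\mathcal{X}_+,\mathcal{X}_-\rangle_{(n)}=\mathbf{0},$$ that is, for every fixed $(i_1,\ldots,i_{n-1},i_{n+1},\ldots,i_N)$ the corresponding mode-$n$ fibers of $\mathcal{X}_+$ and $\mathcal{X}_-$ are orthogonal.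
   Context: For a tensor $\mathcal{X}\in\mathbb{R}^{I_1\times\cdots\times I_N}$, a mode-$n$ fiber is the vector $\mathcal{X}(i_1,\ldots,i_{n-1},:,i_{n+1},\ldots,i_N)\in\mathbb{R}^{I_n}$ obtained by fixing all indices except the $n$th. For a matrix $\mathbf{A}\in\mathbb{R}^{J\times I_n}$, the mode-$n$ product $\mathcal{Y}=\mathcal{X}\times_n\mathbf{A}$ is the tensor obtained by left-multiplying each mode-$n$ fiber by $\mathbf{A}$: $\mathcal{Y}(i_1,\ldots,i_{n-1},:,i_{n+1},\ldots,i_N)=\mathbf{A}\,\mathcal{X}(i_1,\ldots,i_{n-1},:,i_{n+1},\ldots,i_N)$. If $\mathfrak{U}_n$ has dimension $r$ and $\mathbf{U}\in\mathbb{R}^{I_n\times r}$ has columns forming an orthonormal basis of $\mathfrak{U}_n$, the orthogonal projection matrix onto $\mathfrak{U}_n$ is $\mathbf{P}_n=\mathbf{U}\mathbf{U}^\top$. $\mathbf{I}$ is the $I_n\times I_n$ identity matrix. The pair $(\mathcal{X}_+,\mathcal{X}_-)$ is called the Tensor Orthogonal Subspace Split (TOSS) of $\mathcal{X}$ along mode $n$ with respect to $\mathfrak{U}_n$. *)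

theory Defs
  imports Complex_Main "HOL-Library.FuncSet" "Jordan_Normal_Form.VS_Connect"
begin

text \<open>
  The shape of a tensor of order \<open>N\<close> is a list \<open>Is = [I\<^sub>1, \<dots>, I\<^sub>N]\<close> of length \<open>N\<close>.
  As for \<open>vec\<close> and \<open>mat\<close>, indices and modes are counted from 0.
  Tensors are extensional functions on the multi-indices of their shape, so that equality of
  tensors of the same shape is equality of all entries.
\<close>

definition multi_indices :: "nat list \<Rightarrow> nat list set" where
  "multi_indices Is = {is. list_all2 (<) is Is}"

type_synonym tensor = "nat list \<Rightarrow> real"

definition tensors :: "nat list \<Rightarrow> tensor set" where
  "tensors Is = (multi_indices Is \<rightarrow>\<^sub>E UNIV)"

definition zero_tensor :: "nat list \<Rightarrow> tensor" where
  "zero_tensor Is = (\<lambda>is\<in>multi_indices Is. 0)"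

definition delete_mode :: "nat \<Rightarrow> nat list \<Rightarrow> nat list" where
  "delete_mode n xs = take n xs @ drop (Suc n) xs"

definition insert_mode :: "nat \<Rightarrow> nat \<Rightarrow> nat list \<Rightarrow> nat list" where
  "insert_mode n j xs = take n xs @ j # drop n xs"

text \<open>
  A mode-\<open>n\<close> fiber is determined by the remaining \<open>N - 1\<close> indices, that is, by an element of
  \<open>multi_indices (delete_mode n Is)\<close>.
\<close>

definition fiber :: "nat list \<Rightarrow> nat \<Rightarrow> tensor \<Rightarrow> nat list \<Rightarrow> real vec" where
  "fiber Is n X is = vec (Is ! n) (\<lambda>j. X (insert_mode n j is))"

definition mode_product :: "nat list \<Rightarrow> nat \<Rightarrow> tensor \<Rightarrow> real mat \<Rightarrow> tensor" where
  "mode_product Is n X A =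
    (\<lambda>is\<in>multi_indices (Is[n := dim_row A]). (A *\<^sub>v fiber Is n X (delete_mode n is)) $ (is ! n))"

lemma mode_product_tensor: "mode_product Is n X A \<in> tensors (Is[n := dim_row A])"
  by (simp add: mode_product_def tensors_def)

lemma fiber_mode_product:
  assumes "n < length Is" "is \<in> multi_indices (delete_mode n Is)"
  shows "fiber (Is[n := dim_row A]) n (mode_product Is n X A) is = A *\<^sub>v fiber Is n X is"
proof -
  have l: "list_all2 (<) is (take n Is @ drop (Suc n) Is)"
    using assms(2) by (simp add: multi_indices_def delete_mode_def)
  then have len: "length is = length Is - 1"
    using assms(1) by (auto dest: list_all2_lengthD)
  have t: "list_all2 (<) (take n is) (take n Is)"
    using list_all2_takeI[OF l, of n] assms(1) by simp
  have d: "list_all2 (<) (drop n is) (drop (Suc n) Is)"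
    using list_all2_dropI[OF l, of n] assms(1) by simp
  have "insert_mode n j is \<in> multi_indices (Is[n := dim_row A])" if "j < dim_row A" for j
    using t d that assms(1)
    by (simp add: insert_mode_def multi_indices_def upd_conv_take_nth_drop list_all2_appendI)
  moreover have "insert_mode n j is ! n = j" "delete_mode n (insert_mode n j is) = is" for j
    using len assms(1) by (auto simp: insert_mode_def delete_mode_def nth_append min_def)
  ultimately show ?thesis
    using assms(1) by (intro eq_vecI) (auto simp: fiber_def mode_product_def)
qed

definition fiber_inner :: "nat list \<Rightarrow> nat \<Rightarrow> tensor \<Rightarrow> tensor \<Rightarrow> tensor" where
  "fiber_inner Is n X Y =
    (\<lambda>is\<in>multi_indices (delete_mode n Is). fiber Is n X is \<bullet> fiber Is n Y is)"

abbreviation linear_subspace :: "nat \<Rightarrow> real vec set \<Rightarrow> bool" where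
  "linear_subspace d W \<equiv> VectorSpace.subspace class_ring W (module_vec TYPE(real) d)"

text \<open>The subspace \<open>W\<close> of \<open>\<real>\<^sup>d\<close>, regarded as a vector space in its own right.\<close>

abbreviation subspace_vs :: "nat \<Rightarrow> real vec set \<Rightarrow> (real, real vec) module" where
  "subspace_vs d W \<equiv> (module_vec TYPE(real) d)\<lparr>carrier := W\<rparr>"

definition orthonormal_basis_mat :: "nat \<Rightarrow> real vec set \<Rightarrow> real mat \<Rightarrow> bool" where
  "orthonormal_basis_mat d W U \<longleftrightarrow>
    U \<in> carrier_mat d (vectorspace.dim class_ring (subspace_vs d W)) \<and>
    vectorspace.basis class_ring (subspace_vs d W) (set (cols U)) \<and>
    (\<forall>i<dim_col U. \<forall>j<dim_col U. col U i \<bullet> col U j = (if i = j then 1 else 0))"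

definition orthogonal_projection_mat :: "nat \<Rightarrow> real vec set \<Rightarrow> real mat \<Rightarrow> bool" where
  "orthogonal_projection_mat d W P \<longleftrightarrow> (\<exists>U. orthonormal_basis_mat d W U \<and> P = U * U\<^sup>T)"

end

(* The columns of U are orthonormal, so U\<^sup>T U = 1. Hence U\<^sup>T annihilates the residual v - U U\<^sup>T v, which
   is therefore orthogonal to the range of U, in particular to U U\<^sup>T v. *)

theory Submission
  imports Defs
begin

text \<open>The entries of \<open>U\<^sup>T * U\<close> are the inner products of the columns of
  \<open>U\<close>, so orthonormality is this matrix identity.\<close>

lemma orthonormal_basis_mat_transpose_mult:
  assumes "orthonormal_basis_mat d W U"
  shows "U\<^sup>T * U = 1\<^sub>m (dim_col U)"
  using assms by (intro eq_matI) (auto simp: orthonormal_basis_mat_def)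

lemma orthogonal_projection_mat_carrier:
  assumes "orthogonal_projection_mat d W P"
  shows "P \<in> carrier_mat d d"
  using assms by (auto simp: orthogonal_projection_mat_def orthonormal_basis_mat_def)

text \<open>This is the theorem for a single fiber; mode products act on each fiber separately, so
  the tensor case reduces to it.\<close>

lemma orthogonal_projection_mat_inner_residual:
  assumes P: "orthogonal_projection_mat d W P" and v: "v \<in> carrier_vec d"
  shows "(P *\<^sub>v v) \<bullet> ((1\<^sub>m d - P) *\<^sub>v v) = 0"
proof -
  obtain U where U: "orthonormal_basis_mat d W U" and PU: "P = U * U\<^sup>T"
    using P by (auto simp: orthogonal_projection_mat_def)
  define r where "r = dim_col U"
  have Uc: "U \<in> carrier_mat d r"
    using U by (auto simp: orthonormal_basis_mat_def r_def)
  then have UT: "U\<^sup>T \<in> carrier_mat r d"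
    by simp
  \<comment> \<open>The coordinates of the projection of \<open>v\<close> in the orthonormal basis
    formed by the columns of \<open>U\<close>.\<close>
  define w where "w = U\<^sup>T *\<^sub>v v"
  have w: "w \<in> carrier_vec r"
    using UT v by (simp add: w_def)
  have Uw: "U *\<^sub>v w \<in> carrier_vec d"
    using Uc w by simp
  have Pv: "P *\<^sub>v v = U *\<^sub>v w"
    unfolding PU w_def using Uc UT v by (rule assoc_mult_mat_vec)
  have res: "(1\<^sub>m d - P) *\<^sub>v v = v - U *\<^sub>v w"
    using minus_mult_distrib_mat_vec[OF one_carrier_mat orthogonal_projection_mat_carrier[OF P] v] v
    by (simp add: Pv)
  have "U\<^sup>T *\<^sub>v (v - U *\<^sub>v w) = w - (U\<^sup>T * U) *\<^sub>v w"
    using mult_minus_distrib_mat_vec[OF UT v Uw] assoc_mult_mat_vec[OF UT Uc w]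
    by (simp add: w_def)
  also have "\<dots> = 0\<^sub>v r"
    using orthonormal_basis_mat_transpose_mult[OF U] w by (simp add: r_def)
  finally have zero: "U\<^sup>T *\<^sub>v (v - U *\<^sub>v w) = 0\<^sub>v r" .
  \<comment> \<open>The factors are swapped so that \<open>U\<close> stands in the right argument,
    from where it moves to the left one as its transpose.\<close>
  have "(U *\<^sub>v w) \<bullet> (v - U *\<^sub>v w) = (v - U *\<^sub>v w) \<bullet> (U *\<^sub>v w)"
    using Uw v by (intro comm_scalar_prod[of _ d]) auto
  also have "\<dots> = (U\<^sup>T *\<^sub>v (v - U *\<^sub>v w)) \<bullet> w"
    using Uc w Uw v by (intro transpose_vec_mult_scalar[symmetric]) auto
  also have "\<dots> = 0"
    using w by (simp add: zero)
  finally show ?thesis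
    by (simp add: Pv res)
qed

theorem mainTheorem1:
  fixes Is :: "nat list" and n :: nat and X :: tensor
    and W :: "real vec set" and P :: "real mat"
  defines "Xplus \<equiv> mode_product Is n X P"
    and "Xminus \<equiv> mode_product Is n X (1\<^sub>m (Is ! n) - P)"
  assumes "n < length Is"
    and "X \<in> tensors Is"
    and "linear_subspace (Is ! n) W"
    and "orthogonal_projection_mat (Is ! n) W P"
  shows "fiber_inner Is n Xplus Xminus = zero_tensor (delete_mode n Is)
    \<and> (\<forall>is\<in>multi_indices (delete_mode n Is). fiber Is n Xplus is \<bullet> fiber Is n Xminus is = 0)"
proof -
  \<comment> \<open>Since \<open>P\<close> and \<open>1\<^sub>m (Is ! n) - P\<close> both have
    \<open>Is ! n\<close> rows, the updated shape \<open>Is[n := dim_row A]\<close> in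
    \<open>fiber_mode_product\<close> is \<open>Is\<close> again.\<close>
  have dim: "dim_row P = Is ! n"
    using orthogonal_projection_mat_carrier[OF assms(6)] by simp
  have orth: "fiber Is n Xplus is \<bullet> fiber Is n Xminus is = 0"
    if "is \<in> multi_indices (delete_mode n Is)" for "is"
  proof -
    have "fiber Is n Xplus is = P *\<^sub>v fiber Is n X is"
      using fiber_mode_product[OF assms(3) that, of P X] by (simp add: Xplus_def dim)
    moreover have "fiber Is n Xminus is = (1\<^sub>m (Is ! n) - P) *\<^sub>v fiber Is n X is"
      using fiber_mode_product[OF assms(3) that, of "1\<^sub>m (Is ! n) - P" X]
      by (simp add: Xminus_def dim)
    ultimately show ?thesis
      \<comment> \<open>Unfolding \<open>fiber_def\<close> shows that the fiber has dimension
        \<open>Is ! n\<close>.\<close>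
      using orthogonal_projection_mat_inner_residual[OF assms(6)] by (simp add: fiber_def)
  qed
  then show ?thesis
    \<comment> \<open>Both tensors are restrictions to the same index set, so entrywise equality
      suffices.\<close>
    by (auto simp: fiber_inner_def zero_tensor_def intro!: restrict_ext)
qed

end
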